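(* Let $n \ge 1$ be an integer. There exists a constant $C = C(n) > 0$, depending only on $n$, such that the following holds. Let $f(x) = \alpha_n x^n + \dots + \alpha_1 x + \alpha_0$ be a polynomial of degree $n$ with real coefficients, and let $\delta, X \in \mathbb{R}$ satisfy $0 \le \delta \le 1/4$ and $X \ge 2$. Let $$\Gamma_{\delta} := \{(x,y) \in \mathbb{R}^2 :\ x \in [X,2X],\ |y-f(x)| \le \delta\}, \qquad \mathcal{S} := \#(\Gamma_{\delta} \cap \mathbb{Z}^2),$$ and let $\mathcal{R}$ be the maximal number of integer points in $\Gamma_{\delta}$ that are all on a polynomial of degree at most $n$. Then $$\mathcal{S} \le C\left(\delta^{\frac{2}{n(n+1)}}X+\mathcal{R}\right).$$
   Context: An integer point is an element of $\mathbb{Z}^2$. A set of points is said to be "all on a polynomial of degree at most $n$" if there is a single polynomial $P$ of degree at most $n$ such that every point $(x,y)$ of the set satisfies $y = P(x)$; thus $\mathcal{R}$ is the maximum, over all polynomials $P$ of degree at most $n$, of $\#\{(x,y) \in \Gamma_\delta \cap \mathbb{Z}^2 : y = P(x)\}$. *)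

theory Defs
  imports "HOL-Analysis.Analysis" "HOL-Computational_Algebra.Polynomial"
begin

definition curve_nbhd :: "real poly \<Rightarrow> real \<Rightarrow> real \<Rightarrow> (real \<times> real) set" where
  "curve_nbhd f \<delta> X = {(x, y). x \<in> {X..2 * X} \<and> \<bar>y - poly f x\<bar> \<le> \<delta>}"

definition integer_points :: "(real \<times> real) set" where
  "integer_points = \<int> \<times> \<int>"

definition num_points :: "real poly \<Rightarrow> real \<Rightarrow> real \<Rightarrow> nat" where
  "num_points f \<delta> X = card (curve_nbhd f \<delta> X \<inter> integer_points)"

definition num_points_on :: "real poly \<Rightarrow> real \<Rightarrow> real \<Rightarrow> real poly \<Rightarrow> nat" where
  "num_points_on f \<delta> X P =
     card {(x, y). (x, y) \<in> curve_nbhd f \<delta> X \<inter> integer_points \<and> y = poly P x}"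

text \<open>There are infinitely many competing polynomials, but they give only finitely many
  counts; see \<open>finite_num_points_on\<close> below. So the maximum is a genuine one.\<close>

definition max_points_on_poly :: "nat \<Rightarrow> real poly \<Rightarrow> real \<Rightarrow> real \<Rightarrow> nat" where
  "max_points_on_poly n f \<delta> X = Max (num_points_on f \<delta> X ` {P. degree P \<le> n})"

lemma finite_nbhd_integer_points: "finite (curve_nbhd f \<delta> X \<inter> integer_points)"
proof -
  have "compact (poly f ` {X..2 * X})"
    by (intro compact_continuous_image continuous_intros compact_Icc)
  then have "bounded (poly f ` {X..2 * X})"
    by (rule compact_imp_bounded)
  then obtain B where B: "\<And>x. x \<in> {X..2 * X} \<Longrightarrow> \<bar>poly f x\<bar> \<le> B"
    unfolding bounded_iff by (metis imageI real_norm_def)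
  let ?I = "\<lambda>a b. {x \<in> \<int>. a \<le> x \<and> x \<le> (b :: real)}"
  have "curve_nbhd f \<delta> X \<inter> integer_points
          \<subseteq> ?I X (2 * X) \<times> ?I (- B - \<delta>) (B + \<delta>)"
    using B by (fastforce simp: curve_nbhd_def integer_points_def abs_le_iff)
  then show ?thesis
    by (rule finite_subset) (intro finite_cartesian_product finite_int_segment)
qed

lemma num_points_on_le: "num_points_on f \<delta> X P \<le> num_points f \<delta> X"
  unfolding num_points_on_def num_points_def
  by (intro card_mono finite_nbhd_integer_points) auto

lemma finite_num_points_on: "finite (num_points_on f \<delta> X ` A)"
  by (rule finite_subset[of _ "{..num_points f \<delta> X}"]) (auto simp: num_points_on_le)

end

theory Submission
  imports Defs
begin

text \<open>
  Distinct integer points of the strip have distinct abscissae because \<open>\<delta> < 1/2\<close>, so a point is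
  determined by its abscissa \<open>x\<close>, with ordinate \<open>round (f x)\<close>. Cut the points, from left to
  right, into runs, each the longest one that lies on a single polynomial of degree at most
  \<open>n\<close>. The last run has at most \<open>\<R>\<close> points. The theorem follows if every other run pays for
  itself: when \<open>k\<close> points starting at \<open>x\<close> lie on \<open>P\<close> and the next point \<open>(z, y)\<close> does
  not, then \<open>k \<le> C \<delta>\<^sup>2\<^sup>/\<^sup>(\<^sup>n\<^sup>(\<^sup>n\<^sup>+\<^sup>1\<^sup>)\<^sup>) (z - x)\<close>. The distances \<open>z - x\<close> telescope to at
  most \<open>X\<close>, and only one run costs \<open>\<R>\<close> (\<open>card_le_runs\<close>).

  The bound for one run (\<open>off_polynomial_gap\<close>) compares two estimates of \<open>y - P(z)\<close>; put
  \<open>M = z - x\<close>.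

  \<^item> It is not small. If \<open>P\<close> takes integral values on a set \<open>A\<close> of \<open>n + 1\<close> integers,
    Lagrange interpolation shows that the Vandermonde product \<open>V(A)\<close> clears the denominators of
    \<open>P\<close> at all integers, so \<open>\<bar>y - P(z)\<bar> \<ge> 1 / V(A)\<close>. Take for \<open>A\<close> the tightest \<open>n + 1\<close>
    consecutive abscissae of the run, of diameter \<open>g\<close>; then \<open>V(A) \<le> g\<^sup>n\<^sup>(\<^sup>n\<^sup>+\<^sup>1\<^sup>)\<^sup>/\<^sup>2\<close>.

  \<^item> It is not large. \<open>f - P\<close> is at most \<open>\<delta>\<close> on the run, and by the choice of \<open>g\<close> any \<open>n\<close>
    steps along the run cover a distance at least \<open>g\<close>. Hence, if \<open>k > n\<^sup>2\<close>, one finds \<open>n + 1\<close>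
    abscissae whose mutual distances are at least of order \<open>g k / n\<^sup>2\<close>, and interpolating \<open>f - P\<close>
    there gives
    \<open>\<bar>y - P(z)\<bar> \<le> \<delta> + (n + 1) \<delta> (c M / (g k))\<^sup>n\<close>, with \<open>c\<close> depending only on \<open>n\<close>.

  Together, \<open>1\<close> is at most a constant times \<open>\<delta> g\<^sup>n\<^sup>(\<^sup>n\<^sup>-\<^sup>1\<^sup>)\<^sup>/\<^sup>2 (M / k)\<^sup>n\<close>. As \<open>g\<close> is itself at most
  of order \<open>M / k\<close>, this is at most a constant times \<open>\<delta> (M / k)\<^sup>n\<^sup>(\<^sup>n\<^sup>+\<^sup>1\<^sup>)\<^sup>/\<^sup>2\<close>, which is the
  claim. If \<open>k \<le> n\<^sup>2\<close>, interpolating \<open>f - P\<close> on \<open>A\<close> itself gives a bound of the same shape. A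
  single diameter governs both estimates, and this makes the gap after a run grow linearly with
  the number of its points.
\<close>

section \<open>Lagrange interpolation at integer nodes\<close>

definition lagrange_basis :: "int set \<Rightarrow> int \<Rightarrow> real poly" where
  "lagrange_basis A a = (\<Prod>b\<in>A - {a}. smult (1 / real_of_int (a - b)) [:- real_of_int b, 1:])"

lemma poly_lagrange_basis:
  "poly (lagrange_basis A a) x = (\<Prod>b\<in>A - {a}. (x - real_of_int b) / real_of_int (a - b))"
  unfolding lagrange_basis_def poly_prod by (intro prod.cong) (auto simp: diff_divide_distrib)

lemma poly_lagrange_basis_node:
  assumes "finite A" "a \<in> A" "c \<in> A"
  shows "poly (lagrange_basis A a) (real_of_int c) = (if c = a then 1 else 0)"
proof (cases "c = a")
  case True
  then show ?thesis
    by (auto simp: poly_lagrange_basis intro!: prod.neutral)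
next
  case False
  then show ?thesis
    using assms by (auto simp: poly_lagrange_basis)
qed

lemma degree_lagrange_basis:
  assumes "finite A" "a \<in> A"
  shows "degree (lagrange_basis A a) < card A"
proof -
  have "degree (lagrange_basis A a)
          \<le> (\<Sum>b\<in>A - {a}. degree (smult (1 / real_of_int (a - b)) [:- real_of_int b, 1:]))"
    unfolding lagrange_basis_def using assms by (intro degree_prod_sum_le[THEN order_trans]) auto
  also have "\<dots> \<le> (\<Sum>b\<in>A - {a}. 1)"
    by (intro sum_mono) auto
  also have "\<dots> < card A"
    using assms card_gt_0_iff[of A] by auto
  finally show ?thesis .
qed

definition interpolant :: "int set \<Rightarrow> (int \<Rightarrow> real) \<Rightarrow> real poly" where
  "interpolant A v = (\<Sum>a\<in>A. smult (v a) (lagrange_basis A a))"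

lemma poly_interpolant_node:
  assumes "finite A" "c \<in> A"
  shows "poly (interpolant A v) (real_of_int c) = v c"
  using assms by (simp add: interpolant_def poly_sum poly_lagrange_basis_node if_distrib sum.delta cong: if_cong)

lemma degree_interpolant:
  assumes "finite A" "A \<noteq> {}"
  shows "degree (interpolant A v) < card A"
  unfolding interpolant_def using assms
  by (intro degree_sum_less)
     (auto intro!: degree_lagrange_basis simp: card_gt_0_iff)

lemma lagrange_interpolation:
  assumes "finite A" "degree P < card A"
  shows "poly P x = (\<Sum>a\<in>A. poly P (real_of_int a) * poly (lagrange_basis A a) x)"
proof -
  have "A \<noteq> {}" using assms by auto
  let ?I = "interpolant A (\<lambda>a. poly P (real_of_int a))"
  have "P = ?I"
  proof (rule poly_eqI_degree[of "real_of_int ` A"])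
    show "poly P x = poly ?I x" if "x \<in> real_of_int ` A" for x
      using that assms poly_interpolant_node by auto
    show "degree P < card (real_of_int ` A)"
      using assms by (simp add: card_image inj_on_def)
    show "degree ?I < card (real_of_int ` A)"
      using degree_interpolant[OF assms(1) \<open>A \<noteq> {}\<close>] by (simp add: card_image inj_on_def)
  qed
  then have "poly P x = poly ?I x" by simp
  also have "\<dots> = (\<Sum>a\<in>A. poly P (real_of_int a) * poly (lagrange_basis A a) x)"
    by (simp add: interpolant_def poly_sum)
  finally show ?thesis .
qed

section \<open>Vandermonde products and denominators\<close>

definition vandermonde :: "int set \<Rightarrow> int" where
  "vandermonde A = (\<Prod>(a, b)\<in>{(a, b). a \<in> A \<and> b \<in> A \<and> a < b}. b - a)"

text \<open>
  Each pair of elements either avoids \<open>a\<close> or is \<open>a\<close> together with one other element. The second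
  factor is, up to sign, the denominator of the Lagrange basis polynomial at \<open>a\<close>; this is why \<open>V(A)\<close>
  clears that denominator.
\<close>

lemma vandermonde_remove:
  assumes "finite A" "a \<in> A"
  shows "vandermonde A = vandermonde (A - {a}) * (\<Prod>b\<in>A - {a}. \<bar>a - b\<bar>)"
proof -
  let ?P = "\<lambda>A::int set. {(a, b). a \<in> A \<and> b \<in> A \<and> a < b}"
  let ?h = "\<lambda>b. (min a b, max a b)"
  have fin: "finite (?P A)" if "finite A" for A :: "int set"
    by (rule finite_subset[of _ "A \<times> A"]) (use that in auto)
  have "?P A = ?P (A - {a}) \<union> ?h ` (A - {a})"
  proof (intro equalityI subsetI)
    fix p assume p: "p \<in> ?P A"
    obtain c d where cd: "p = (c, d)" by (cases p)
    consider "c = a" | "d = a" | "c \<noteq> a" "d \<noteq> a" by blast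
    then show "p \<in> ?P (A - {a}) \<union> ?h ` (A - {a})"
    proof cases
      case 1
      then have "p = ?h d" "d \<in> A - {a}" using p cd by auto
      then show ?thesis by blast
    next
      case 2
      then have "p = ?h c" "c \<in> A - {a}" using p cd by auto
      then show ?thesis by blast
    qed (use p cd in auto)
  qed (use assms in \<open>auto simp: min_def max_def split: if_splits\<close>)
  moreover have "?P (A - {a}) \<inter> ?h ` (A - {a}) = {}"
    by (auto simp: min_def max_def split: if_splits)
  moreover have "inj_on ?h (A - {a})"
    by (auto simp: inj_on_def min_def max_def split: if_splits)
  ultimately have "vandermonde A
      = vandermonde (A - {a}) * (\<Prod>b\<in>A - {a}. max a b - min a b)"
    unfolding vandermonde_def using assms fin[of "A - {a}"]
    by (simp add: prod.union_disjoint prod.reindex)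
  also have "(\<Prod>b\<in>A - {a}. max a b - min a b) = (\<Prod>b\<in>A - {a}. \<bar>a - b\<bar>)"
    by (intro prod.cong) auto
  finally show ?thesis .
qed

lemma vandermonde_pos: "vandermonde A > 0"
  unfolding vandermonde_def by (intro prod_pos) auto

lemma vandermonde_le:
  fixes g :: int
  assumes "finite A" "\<And>a b. a \<in> A \<Longrightarrow> b \<in> A \<Longrightarrow> \<bar>a - b\<bar> \<le> g"
  shows "vandermonde A \<le> g ^ (card A * (card A - 1) div 2)"
  using assms
proof (induction A rule: finite_induct)
  case empty
  then show ?case by (simp add: vandermonde_def)
next
  case (insert a A)
  have eq: "card (insert a A) * (card (insert a A) - 1) div 2 = card A * (card A - 1) div 2 + card A"
  proof -
    have "Suc m * m div 2 = m * (m - 1) div 2 + m" for m :: nat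
      by (cases m) (simp_all add: algebra_simps)
    then show ?thesis using insert by simp
  qed
  have "vandermonde (insert a A) = vandermonde A * (\<Prod>b\<in>A. \<bar>a - b\<bar>)"
    using vandermonde_remove[of "insert a A" a] insert by simp
  also have "\<dots> \<le> g ^ (card A * (card A - 1) div 2) * (\<Prod>b\<in>A. g)"
    using insert vandermonde_pos[of A]
    by (intro mult_mono prod_mono insert.IH) (auto intro!: prod_nonneg zero_le_power)
  finally show ?case
    unfolding eq by (simp add: power_add)
qed

lemma vandermonde_mult_basis:
  assumes "finite A" "a \<in> A"
  shows "\<bar>real_of_int (vandermonde A) * poly (lagrange_basis A a) x\<bar>
           = real_of_int (vandermonde (A - {a})) * (\<Prod>b\<in>A - {a}. \<bar>x - real_of_int b\<bar>)"
proof -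
  have "(\<Prod>b\<in>A - {a}. real_of_int \<bar>a - b\<bar>) \<noteq> 0"
    using assms by (simp add: prod_zero_iff)
  then show ?thesis
    unfolding vandermonde_remove[OF assms] poly_lagrange_basis
    using vandermonde_pos[of "A - {a}"]
    by (simp add: abs_mult abs_prod prod_dividef)
qed

text \<open>
  By \<open>vandermonde_mult_basis\<close>, multiplying a Lagrange basis polynomial by \<open>V(A)\<close> leaves, up to
  sign, a product of integers at every integer.
\<close>

lemma vandermonde_mult_poly_Ints:
  assumes A: "finite A" "degree P < card A"
    and P: "\<And>a. a \<in> A \<Longrightarrow> poly P (real_of_int a) \<in> \<int>"
  shows "real_of_int (vandermonde A) * poly P (real_of_int z) \<in> \<int>"
proof -
  have "poly P (real_of_int a) * (real_of_int (vandermonde A) * poly (lagrange_basis A a) (real_of_int z)) \<in> \<int>"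
    if a: "a \<in> A" for a
  proof -
    have "\<bar>real_of_int (vandermonde A) * poly (lagrange_basis A a) (real_of_int z)\<bar>
           = real_of_int (vandermonde (A - {a}) * (\<Prod>b\<in>A - {a}. \<bar>z - b\<bar>))"
      using vandermonde_mult_basis[OF A(1) a, of "real_of_int z"] by simp
    then have "\<bar>real_of_int (vandermonde A) * poly (lagrange_basis A a) (real_of_int z)\<bar> \<in> \<int>"
      by (metis Ints_of_int)
    then show ?thesis
      using P[OF a] by (auto simp: abs_if intro: Ints_mult split: if_splits)
  qed
  then have "(\<Sum>a\<in>A. poly P (real_of_int a) *
      (real_of_int (vandermonde A) * poly (lagrange_basis A a) (real_of_int z))) \<in> \<int>"
    by (rule Ints_sum)
  then show ?thesis
    by (subst lagrange_interpolation[OF A]) (simp add: sum_distrib_left mult_ac)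
qed

section \<open>A point off a polynomial that carries many points\<close>

text \<open>
  \<open>V(A) (y - P(z))\<close> is a nonzero integer. It is the sum of \<open>V(A) (y - f(z))\<close> and
  \<open>V(A) (f - P)(z)\<close>, and the latter is expanded over the nodes \<open>B\<close>. Two node sets are allowed
  because they have opposite tasks: \<open>A\<close> should be tight, to keep \<open>V(A)\<close> small, and \<open>B\<close> spread
  out, to extrapolate \<open>f - P\<close> without much loss.
\<close>

lemma one_le_off_polynomial:
  fixes W \<delta> y :: real
  assumes A: "finite A" "degree P < card A" "\<And>a. a \<in> A \<Longrightarrow> poly P (real_of_int a) \<in> \<int>"
    and B: "finite B" "degree (f - P) < card B"
      "\<And>b. b \<in> B \<Longrightarrow> \<bar>poly f (real_of_int b) - poly P (real_of_int b)\<bar> \<le> \<delta>"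
    and y: "y \<in> \<int>" "\<bar>y - poly f (real_of_int z)\<bar> \<le> \<delta>" "y \<noteq> poly P (real_of_int z)"
    and W: "real_of_int (vandermonde A) \<le> W"
      "\<And>b. b \<in> B \<Longrightarrow> real_of_int (vandermonde A) * \<bar>poly (lagrange_basis B b) (real_of_int z)\<bar> \<le> W"
  shows "1 \<le> real (card B + 1) * W * \<delta>"
proof -
  let ?V = "real_of_int (vandermonde A)" and ?z = "real_of_int z"
  have V: "?V > 0" using vandermonde_pos[of A] by simp
  have \<delta>: "0 \<le> \<delta>" using y(2) by linarith
  have "?V * y - ?V * poly P ?z \<in> \<int>"
    by (intro Ints_diff Ints_mult vandermonde_mult_poly_Ints A y(1) Ints_of_int)
  moreover have "?V * y - ?V * poly P ?z \<noteq> 0"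
    using V y(3) by simp
  ultimately have "1 \<le> \<bar>?V * y - ?V * poly P ?z\<bar>"
    by (rule Ints_nonzero_abs_ge1)
  also have "?V * y - ?V * poly P ?z = ?V * (y - poly f ?z) + ?V * poly (f - P) ?z"
    by (simp add: algebra_simps)
  also have "\<bar>\<dots>\<bar> \<le> W * \<delta> + real (card B) * (W * \<delta>)"
  proof (rule order_trans[OF abs_triangle_ineq add_mono])
    show "\<bar>?V * (y - poly f ?z)\<bar> \<le> W * \<delta>"
      using V W(1) y(2) by (simp add: abs_mult mult_mono)
    have "?V * poly (f - P) ?z
        = (\<Sum>b\<in>B. ?V * poly (lagrange_basis B b) ?z * poly (f - P) (real_of_int b))"
      by (subst lagrange_interpolation[OF B(1,2)]) (simp add: sum_distrib_left mult_ac)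
    also have "\<bar>\<dots>\<bar> \<le> (\<Sum>b\<in>B. W * \<delta>)"
    proof (rule order_trans[OF sum_abs sum_mono])
      fix b assume b: "b \<in> B"
      show "\<bar>?V * poly (lagrange_basis B b) ?z * poly (f - P) (real_of_int b)\<bar> \<le> W * \<delta>"
        using W(2)[OF b] B(3)[OF b] V W(1) by (simp add: abs_mult mult_mono)
    qed
    finally show "\<bar>?V * poly (f - P) ?z\<bar> \<le> real (card B) * (W * \<delta>)"
      by simp
  qed
  finally show ?thesis
    by (simp add: algebra_simps)
qed


text \<open>
  For a run of more than \<open>n\<^sup>2\<close> points, \<open>A\<close> is the tightest block of \<open>n + 1\<close> consecutive points,
  and \<open>B\<close> consists of every \<open>n t\<close>-th point with \<open>t\<close> of order \<open>k / n\<^sup>2\<close>, so that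
  neighbours in \<open>B\<close> are at least \<open>t g\<close> apart. For a shorter run \<open>k\<close> is bounded in terms of \<open>n\<close> and
  \<open>B = A\<close> suffices: there the denominator of the basis polynomial cancels against \<open>V(A)\<close>, which
  gives the same bound as the first case would with \<open>t = 1\<close>.
\<close>

lemma off_polynomial_gap:
  fixes h :: "nat \<Rightarrow> int" and \<delta> y :: real
  assumes n: "1 \<le> n" "n < k"
    and h: "strict_mono_on {..<k} h" "\<And>i. i < k \<Longrightarrow> h i < z"
    and f: "degree f \<le> n" and P: "degree P \<le> n"
    and PInts: "\<And>i. i < k \<Longrightarrow> poly P (real_of_int (h i)) \<in> \<int>"
    and close: "\<And>i. i < k \<Longrightarrow> \<bar>poly f (real_of_int (h i)) - poly P (real_of_int (h i))\<bar> \<le> \<delta>"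
    and y: "y \<in> \<int>" "\<bar>y - poly f (real_of_int z)\<bar> \<le> \<delta>" "y \<noteq> poly P (real_of_int z)"
  shows "1 \<le> real (n + 2) * (4 * (real n)\<^sup>2 * real_of_int (z - h 0) / real k) ^ (n * (n + 1) div 2) * \<delta>"
proof -
  define M where "M = z - h 0"
  have less: "h i < h j" if "i < j" "j < k" for i j
    using h(1) that by (auto simp: strict_mono_on_def)
  have le: "h i \<le> h j" if "i \<le> j" "j < k" for i j
    using less[of i j] that by (cases "i = j") auto
  have inj: "inj_on h {..<k}"
    using h(1) by (rule strict_mono_on_imp_inj_on)
  define g where "g = Min ((\<lambda>i. h (i + n) - h i) ` {..<k - n})"
  have "g \<in> (\<lambda>i. h (i + n) - h i) ` {..<k - n}"
    unfolding g_def using n by (intro Min_in) (auto simp: lessThan_empty_iff)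
  then obtain i0 where "i0 < k - n" "g = h (i0 + n) - h i0"
    by blast
  then have i0: "i0 + n < k" "g = h (i0 + n) - h i0"
    by simp_all
  have g_le: "g \<le> h (i + n) - h i" if "i + n < k" for i
    unfolding g_def using that by (intro Min_le) auto
  have g_pos: "g > 0"
    using less[of i0 "i0 + n"] i0 n by simp
  have spread: "int s * g \<le> h (i + n * s) - h i" if "i + n * s < k" for i s
    using that
  proof (induction s)
    case (Suc s)
    then show ?case
      using g_le[of "i + n * s"] by (simp add: algebra_simps)
  qed simp

  define A where "A = h ` {i0..i0 + n}"
  have A: "finite A" "A \<subseteq> h ` {..<k}" "card A = n + 1"
  proof -
    have "{i0..i0 + n} \<subseteq> {..<k}" using i0 by auto
    then show "card A = n + 1" "A \<subseteq> h ` {..<k}"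
      using card_image[OF inj_on_subset[OF inj]] by (auto simp: A_def)
  qed (simp add: A_def)
  have A_diam: "\<bar>a - b\<bar> \<le> g" if "a \<in> A" "b \<in> A" for a b
  proof -
    have "h i0 \<le> c \<and> c \<le> h (i0 + n)" if "c \<in> A" for c
      using that i0 le by (auto simp: A_def)
    from this[OF that(1)] this[OF that(2)] show ?thesis using i0(2) by linarith
  qed
  have to_z: "0 < z - c \<and> z - c \<le> M" if "c \<in> h ` {..<k}" for c
    using that h(2) le[of 0] by (auto simp: M_def)

  have tri: "(n + 1) * n div 2 = n * (n - 1) div 2 + n"
    by (cases n) (simp_all add: algebra_simps)
  have VA: "vandermonde A \<le> g ^ (n * (n - 1) div 2) * g ^ n"
    using vandermonde_le[OF A(1) A_diam] unfolding A(3) diff_add_inverse2 tri power_add .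

  (* The two cases are brought to one bound, in which t measures how many diameters g fit
     between neighbouring nodes of B; the factor 4 absorbs the rounding in t. *)
  obtain B t where B: "finite B" "B \<subseteq> h ` {..<k}" "card B = n + 1"
    and t: "t \<ge> 1" "k \<le> 4 * n\<^sup>2 * t" "int t * g \<le> M"
    and VB: "\<And>b. b \<in> B \<Longrightarrow> real_of_int (vandermonde A) * \<bar>poly (lagrange_basis B b) (real_of_int z)\<bar>
               \<le> real_of_int g ^ (n * (n - 1) div 2) * (real_of_int M / real t) ^ n"
  proof (cases "k \<le> n\<^sup>2")
    case True
    show ?thesis
    proof (rule that[of A 1])
      have "h i0 \<in> h ` {..<k}" using i0 by auto
      then show "int 1 * g \<le> M"
        using to_z[of "h i0"] h(2)[OF i0(1)] i0(2) by simp
      fix b assume b: "b \<in> A"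
      have "vandermonde (A - {b}) \<le> g ^ (n * (n - 1) div 2)"
        using vandermonde_le[of "A - {b}" g] A_diam A b by auto
      then have V: "real_of_int (vandermonde (A - {b})) \<le> real_of_int g ^ (n * (n - 1) div 2)"
        by (metis of_int_le_iff of_int_power)
      have "(\<Prod>c\<in>A - {b}. \<bar>real_of_int z - real_of_int c\<bar>) \<le> (\<Prod>c\<in>A - {b}. real_of_int M)"
      proof (rule prod_mono)
        fix c assume "c \<in> A - {b}"
        then have "\<bar>z - c\<bar> \<le> M" using to_z[of c] A(2) by auto
        then show "0 \<le> \<bar>real_of_int z - real_of_int c\<bar> \<and> \<bar>real_of_int z - real_of_int c\<bar> \<le> real_of_int M"
          by linarith
      qed
      also have "\<dots> = real_of_int M ^ n"
        using A b by simp
      finally have "real_of_int (vandermonde (A - {b})) * (\<Prod>c\<in>A - {b}. \<bar>real_of_int z - real_of_int c\<bar>)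
          \<le> real_of_int g ^ (n * (n - 1) div 2) * real_of_int M ^ n"
        using V g_pos by (intro mult_mono prod_nonneg) auto
      then show "real_of_int (vandermonde A) * \<bar>poly (lagrange_basis A b) (real_of_int z)\<bar>
               \<le> real_of_int g ^ (n * (n - 1) div 2) * (real_of_int M / real 1) ^ n"
        using vandermonde_mult_basis[OF A(1) b, of "real_of_int z"] vandermonde_pos[of A]
        by (simp add: abs_mult)
    qed (use A True in auto)
  next
    case False
    define t where "t = (k - 1) div n\<^sup>2"
    have t1: "t \<ge> 1"
    proof -
      have "n\<^sup>2 \<le> k - 1" using False by linarith
      then show ?thesis using n div_le_mono[of "n\<^sup>2" "k - 1" "n\<^sup>2"] by (simp add: t_def)
    qed
    have tk: "n\<^sup>2 * t \<le> k - 1"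
      unfolding t_def by simp
    have kt: "k - 1 < n\<^sup>2 * t + n\<^sup>2"
      using n dividend_less_times_div[of "n\<^sup>2" "k - 1"] by (simp add: t_def)
    have "n\<^sup>2 * 1 \<le> n\<^sup>2 * t" using t1 by (rule mult_le_mono2)
    then have k4: "k \<le> 4 * n\<^sup>2 * t" using kt by linarith
    have idx: "i * (n * t) < k" if "i \<le> n" for i
    proof -
      have "i * (n * t) \<le> n * (n * t)" using that by (rule mult_le_mono1)
      also have "\<dots> = n\<^sup>2 * t" by (simp add: power2_eq_square)
      finally show ?thesis using tk n by linarith
    qed
    define B where "B = (\<lambda>i. h (i * (n * t))) ` {..n}"
    have apart: "int t * g \<le> h (j * (n * t)) - h (i * (n * t))" if "i < j" "j \<le> n" for i j
    proof -
      have step: "i * (n * t) + n * t \<le> j * (n * t)"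
        using that mult_le_mono1[of "Suc i" j "n * t"] by simp
      then have "int t * g \<le> h (i * (n * t) + n * t) - h (i * (n * t))"
        using idx[OF that(2)] by (intro spread) simp
      also have "h (i * (n * t) + n * t) \<le> h (j * (n * t))"
        using step idx[OF that(2)] by (rule le)
      finally show ?thesis by simp
    qed
    have tg: "0 < int t * g" using t1 g_pos by simp
    have "inj_on (\<lambda>i. h (i * (n * t))) {..n}"
    proof (rule linorder_inj_onI)
      fix i j assume "i < j" "i \<in> {..n}" "j \<in> {..n}"
      then show "h (i * (n * t)) \<noteq> h (j * (n * t))"
        using apart[of i j] tg by auto
    qed auto
    then have cardB: "card B = n + 1"
      by (simp add: B_def card_image)
    have BH: "B \<subseteq> h ` {..<k}"
      using idx by (auto simp: B_def)
    have apartB: "int t * g \<le> \<bar>b - c\<bar>" if bc: "b \<in> B" "c \<in> B" "c \<noteq> b" for b c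
    proof -
      obtain i j where ij: "b = h (i * (n * t))" "i \<le> n" "c = h (j * (n * t))" "j \<le> n"
        using bc by (auto simp: B_def)
      consider "i < j" | "j < i" using ij bc by (metis nat_neq_iff)
      then show ?thesis
        using apart[of i j] apart[of j i] ij by cases auto
    qed
    show ?thesis
    proof (rule that[of B t])
      have "int t * g \<le> h (n * t) - h 0"
        using apart[of 0 1] n by simp
      also have "\<dots> \<le> M"
        using h(2)[OF idx[of 1]] n by (simp add: M_def)
      finally show tgM: "int t * g \<le> M" .
      fix b assume b: "b \<in> B"
      have "\<bar>poly (lagrange_basis B b) (real_of_int z)\<bar>
          = (\<Prod>c\<in>B - {b}. \<bar>real_of_int z - real_of_int c\<bar> / \<bar>real_of_int (b - c)\<bar>)"
        by (simp add: poly_lagrange_basis abs_prod)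
      also have "\<dots> \<le> (\<Prod>c\<in>B - {b}. real_of_int M / (real t * real_of_int g))"
      proof (rule prod_mono)
        fix c assume c: "c \<in> B - {b}"
        then have "\<bar>z - c\<bar> \<le> M" using to_z[of c] BH by auto
        then have 1: "\<bar>real_of_int z - real_of_int c\<bar> \<le> real_of_int M" by linarith
        have "int t * g \<le> \<bar>b - c\<bar>" using apartB b c by auto
        then have "real_of_int (int t * g) \<le> real_of_int \<bar>b - c\<bar>" by (rule of_int_le_iff[THEN iffD2])
        then have 2: "real t * real_of_int g \<le> \<bar>real_of_int (b - c)\<bar>" by simp
        have 3: "0 < real t * real_of_int g" using t1 g_pos by simp
        show "0 \<le> \<bar>real_of_int z - real_of_int c\<bar> / \<bar>real_of_int (b - c)\<bar>
          \<and> \<bar>real_of_int z - real_of_int c\<bar> / \<bar>real_of_int (b - c)\<bar> \<le> real_of_int M / (real t * real_of_int g)"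
          using frac_le[OF _ 1 3 2] 1 by auto
      qed
      also have "\<dots> = (real_of_int M / real t) ^ n / real_of_int g ^ n"
        using b cardB B_def by (simp add: power_divide power_mult_distrib)
      finally have L: "\<bar>poly (lagrange_basis B b) (real_of_int z)\<bar>
          \<le> (real_of_int M / real t) ^ n / real_of_int g ^ n" .
      have V: "real_of_int (vandermonde A) \<le> real_of_int g ^ (n * (n - 1) div 2) * real_of_int g ^ n"
        using VA by (metis of_int_le_iff of_int_power of_int_mult)
      have "real_of_int (vandermonde A) * \<bar>poly (lagrange_basis B b) (real_of_int z)\<bar>
          \<le> (real_of_int g ^ (n * (n - 1) div 2) * real_of_int g ^ n)
              * ((real_of_int M / real t) ^ n / real_of_int g ^ n)"
        using L V g_pos by (intro mult_mono) auto
      also have "\<dots> = real_of_int g ^ (n * (n - 1) div 2) * (real_of_int M / real t) ^ n"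
        using g_pos by simp
      finally show "real_of_int (vandermonde A) * \<bar>poly (lagrange_basis B b) (real_of_int z)\<bar>
          \<le> real_of_int g ^ (n * (n - 1) div 2) * (real_of_int M / real t) ^ n" .
    qed (use B_def cardB BH t1 k4 in auto)
  qed

  (* Both M / t and g are at most ?Q, so all the factors merge into one power of ?Q. *)
  let ?Q = "4 * (real n)\<^sup>2 * real_of_int M / real k"
  let ?W = "?Q ^ (n * (n + 1) div 2)"
  have M_pos: "M > 0"
    using h(2)[of 0] n by (simp add: M_def)
  have Mt: "real_of_int M / real t \<le> ?Q"
  proof -
    have "real k \<le> 4 * (real n)\<^sup>2 * real t"
      using of_nat_mono[OF t(2), where 'a = real] by simp
    then have "real_of_int M * real k \<le> real_of_int M * (4 * (real n)\<^sup>2 * real t)"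
      using M_pos by (intro mult_left_mono) auto
    then show ?thesis
      using t(1) n by (simp add: pos_divide_le_eq pos_le_divide_eq mult_ac)
  qed
  have gt: "real_of_int g \<le> real_of_int M / real t"
  proof -
    have "real_of_int (int t * g) \<le> real_of_int M" using t(3) by (rule of_int_le_iff[THEN iffD2])
    then show ?thesis using t(1) by (simp add: field_simps)
  qed
  have W: "real_of_int g ^ (n * (n - 1) div 2) * (real_of_int M / real t) ^ n \<le> ?W"
  proof -
    have "real_of_int g ^ (n * (n - 1) div 2) * (real_of_int M / real t) ^ n
        \<le> ?Q ^ (n * (n - 1) div 2) * ?Q ^ n"
      using Mt gt g_pos M_pos by (intro mult_mono power_mono) auto
    also have "\<dots> = ?W"
      unfolding mult.commute[of n "n + 1"] tri power_add ..
    finally show ?thesis .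
  qed
  have "1 \<le> real (card B + 1) * ?W * \<delta>"
  proof (rule one_le_off_polynomial[OF A(1) _ _ B(1) _ _ y])
    have "real_of_int (vandermonde A) \<le> real_of_int g ^ (n * (n - 1) div 2) * real_of_int g ^ n"
      using VA by (metis of_int_le_iff of_int_power of_int_mult)
    also have "\<dots> \<le> real_of_int g ^ (n * (n - 1) div 2) * (real_of_int M / real t) ^ n"
      using gt g_pos by (intro mult_left_mono power_mono) auto
    finally show "real_of_int (vandermonde A) \<le> ?W" using W by linarith
    show "degree (f - P) < card B"
      using f P B(3) degree_diff_le[of f n P] by simp
    show "real_of_int (vandermonde A) * \<bar>poly (lagrange_basis B b) (real_of_int z)\<bar> \<le> ?W"
      if "b \<in> B" for b
      using VB[OF that] W by linarith
  qed (use P A B PInts close in auto)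
  then show ?thesis
    using B(3) by (simp add: M_def add.commute)
qed

section \<open>Counting by maximal runs\<close>

text \<open>
  The greedy decomposition: let \<open>z\<close> be the first point at which the initial segment of \<open>G\<close> ceases
  to satisfy \<open>on\<close>, and split off the segment \<open>H\<close> before it. The rest starts at \<open>z\<close>, so the charge \<open>\<kappa> (z - a)\<close> for
  \<open>H\<close> and the charge \<open>\<kappa> (b - z)\<close> for the rest add up, while \<open>R\<close> is paid once, for the final run.
\<close>

lemma card_le_runs:
  fixes G :: "int set" and R \<kappa> a b :: real
  assumes "finite G" and "0 \<le> R" "0 \<le> \<kappa>" "a \<le> b"
    and "\<And>x. x \<in> G \<Longrightarrow> a \<le> real_of_int x \<and> real_of_int x \<le> b"
    and "\<And>x. on {x}"
    and "\<And>H. H \<subseteq> G \<Longrightarrow> on H \<Longrightarrow> real (card H) \<le> R"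
    and "\<And>H z. H \<subseteq> G \<Longrightarrow> z \<in> G \<Longrightarrow> H \<noteq> {} \<Longrightarrow> (\<And>x. x \<in> H \<Longrightarrow> x < z) \<Longrightarrow> on H \<Longrightarrow>
           \<not> on (insert z H) \<Longrightarrow> \<exists>x\<in>H. real (card H) \<le> \<kappa> * real_of_int (z - x)"
  shows "real (card G) \<le> R + \<kappa> * (b - a)"
  using assms
proof (induction G arbitrary: a rule: finite_psubset_induct)
  case (psubset G)
  note single = psubset.prems(5) and on_le = psubset.prems(6) and gap = psubset.prems(7)
  show ?case
  proof (cases "on G \<or> G = {}")
    case True
    then have "real (card G) \<le> R"
      using on_le[of G] psubset.prems(1) by auto
    then show ?thesis
      using psubset.prems(2,3) by (simp add: add_increasing2)
  next
    case False
    let ?Z = "{z \<in> G. \<not> on {x \<in> G. x \<le> z}}"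
    have "{x \<in> G. x \<le> Max G} = G" using psubset.hyps by auto
    then have "Max G \<in> ?Z" using False psubset.hyps by auto
    then have Z: "finite ?Z" "?Z \<noteq> {}" using psubset.hyps by auto
    define z where "z = Min ?Z"
    have z: "z \<in> G" "\<not> on {x \<in> G. x \<le> z}"
      using Min_in[OF Z] by (auto simp: z_def)
    have z_min: "on {x \<in> G. x \<le> y}" if "y \<in> G" "y < z" for y
      using that Min_le[OF Z(1), of y] by (auto simp: z_def)
    define H where "H = {x \<in> G. x < z}"
    define G' where "G' = {x \<in> G. z \<le> x}"
    have ins: "insert z H = {x \<in> G. x \<le> z}" using z by (auto simp: H_def)
    have H_ne: "H \<noteq> {}" using ins z single[of z] by auto
    have finH: "finite H" using psubset.hyps by (simp add: H_def)
    have "{x \<in> G. x \<le> Max H} = H"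
      using Max_in[OF finH H_ne] Max_ge[OF finH] by (force simp: H_def)
    then have onH: "on H"
      using z_min[of "Max H"] Max_in[OF finH H_ne] by (auto simp: H_def)
    obtain x where x: "x \<in> H" "real (card H) \<le> \<kappa> * real_of_int (z - x)"
    proof -
      have "\<exists>x\<in>H. real (card H) \<le> \<kappa> * real_of_int (z - x)"
        using z(2) unfolding ins[symmetric]
        by (intro gap z(1) H_ne onH) (auto simp: H_def)
      then show ?thesis using that by blast
    qed
    have "a \<le> real_of_int x" using x(1) psubset.prems(4) by (auto simp: H_def)
    then have cH: "real (card H) \<le> \<kappa> * (real_of_int z - a)"
      using x(2) psubset.prems(2) by (smt (verit) mult_left_mono of_int_diff)
    have "G' \<subset> G"
    proof -
      obtain w where "w \<in> G" "w < z" using H_ne by (auto simp: H_def)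
      then have "w \<in> G" "w \<notin> G'" by (auto simp: G'_def)
      then show ?thesis by (auto simp: G'_def)
    qed
    then have sub: "G' \<subseteq> G" by blast
    have cG': "real (card G') \<le> R + \<kappa> * (b - real_of_int z)"
    proof (rule psubset.IH[OF \<open>G' \<subset> G\<close> psubset.prems(1,2)])
      show "real_of_int z \<le> b" using psubset.prems(4) z by auto
      show "real_of_int z \<le> real_of_int x \<and> real_of_int x \<le> b" if "x \<in> G'" for x
        using that psubset.prems(4) by (auto simp: G'_def)
      show "on {x}" for x by (rule single)
      show "real (card H) \<le> R" if "H \<subseteq> G'" "on H" for H
        using that sub by (intro on_le) auto
      show "\<exists>x\<in>H. real (card H) \<le> \<kappa> * real_of_int (w - x)"
        if "H \<subseteq> G'" "w \<in> G'" "H \<noteq> {}" "\<And>x. x \<in> H \<Longrightarrow> x < w" "on H" "\<not> on (insert w H)" for H w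
        using that(1,2) sub by (intro gap that(3-6)) auto
    qed
    have "G = H \<union> G'" "H \<inter> G' = {}" by (auto simp: H_def G'_def)
    then have "card G = card H + card G'"
      using finH psubset.hyps by (metis card_Un_disjoint finite_Un)
    then show ?thesis
      using cH cG' by (simp add: algebra_simps)
  qed
qed

text \<open>
  Any \<open>n + 1\<close> points with distinct abscissae lie on a polynomial of degree at most \<open>n\<close>, so a run that
  cannot be prolonged has more than \<open>n\<close> points and the gap estimate applies. Its
  \<open>n (n + 1) / 2\<close>-th root is the bound on the number of points.
\<close>

lemma card_run_le:
  fixes Y :: "int \<Rightarrow> int" and \<delta> :: real
  assumes n: "1 \<le> n" and f: "degree f \<le> n"
    and H: "finite H" "H \<noteq> {}" "\<And>x. x \<in> H \<Longrightarrow> x < z"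
    and P: "degree P \<le> n" "\<And>x. x \<in> H \<Longrightarrow> poly P (real_of_int x) = real_of_int (Y x)"
    and close: "\<And>x. x \<in> insert z H \<Longrightarrow> \<bar>real_of_int (Y x) - poly f (real_of_int x)\<bar> \<le> \<delta>"
    and off: "\<not> (\<exists>Q. degree Q \<le> n \<and> (\<forall>x\<in>insert z H. poly Q (real_of_int x) = real_of_int (Y x)))"
  shows "\<exists>x\<in>H. real (card H)
    \<le> 4 * (real n)\<^sup>2 * real (n + 2) * \<delta> powr (2 / (real n * (real n + 1))) * real_of_int (z - x)"
proof -
  have z: "z \<notin> H" using H(3) by auto
  have "n < card H"
  proof (rule ccontr)
    assume "\<not> n < card H"
    moreover have "degree (interpolant (insert z H) (\<lambda>x. real_of_int (Y x))) < card (insert z H)"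
      using H by (intro degree_interpolant) auto
    ultimately have "degree (interpolant (insert z H) (\<lambda>x. real_of_int (Y x))) \<le> n"
      using H z by simp
    then show False
      using off H(1) poly_interpolant_node[of "insert z H" _ "\<lambda>x. real_of_int (Y x)"] by blast
  qed
  define k where "k = card H"
  define h where "h = (\<lambda>i. sorted_list_of_set H ! i)"
  have h_in: "h i \<in> H" if "i < k" for i
    using that H(1) by (metis h_def k_def length_sorted_list_of_set nth_mem set_sorted_list_of_set)
  have "strict_mono_on {..<k} h"
    unfolding strict_mono_on_def h_def k_def
    using strict_sorted_list_of_set[of H] by (auto simp: sorted_wrt_iff_nth_less)
  have k: "n < k" "k > 0" using \<open>n < card H\<close> by (auto simp: k_def)
  define N where "N = n * (n + 1) div 2"
  have N: "N > 0" "real N = real n * (real n + 1) / 2"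
  proof -
    have "2 * N = n * (n + 1)" by (simp add: N_def)
    then show "real N = real n * (real n + 1) / 2"
      by (metis (no_types, lifting) nonzero_mult_div_cancel_left of_nat_1 of_nat_add of_nat_mult of_nat_numeral zero_neq_numeral)
    then show "N > 0" using n by (cases "N = 0") auto
  qed
  let ?Q = "4 * (real n)\<^sup>2 * real_of_int (z - h 0) / real k"
  have Q: "?Q \<ge> 0" using H(3)[OF h_in[of 0]] k by simp
  have one: "1 \<le> real (n + 2) * ?Q ^ N * \<delta>"
    unfolding N_def
  proof (rule off_polynomial_gap[OF n k(1) \<open>strict_mono_on {..<k} h\<close> _ f P(1), where y = "real_of_int (Y z)"])
    show "\<bar>poly f (real_of_int (h i)) - poly P (real_of_int (h i))\<bar> \<le> \<delta>" if "i < k" for i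
      using close[of "h i"] P(2)[OF h_in[OF that]] h_in[OF that] by (simp add: abs_minus_commute)
    show "real_of_int (Y z) \<noteq> poly P (real_of_int z)"
      using off P by auto
  qed (use h_in H P close in auto)
  (* In particular, for \<delta> = 0 no point can follow a run. *)
  have \<delta>: "\<delta> > 0"
    using one Q by (smt (verit) mult_nonneg_nonpos mult_nonneg_nonneg of_nat_0_le_iff zero_le_power)
  let ?e = "2 / (real n * (real n + 1))"
  have e: "?e = 1 / real N" unfolding N(2) by simp
  have "1 \<le> real (n + 2) * ?Q * \<delta> powr ?e"
  proof -
    have "(\<delta> powr ?e) ^ N = \<delta>"
      using \<delta> N(1) unfolding e by (simp add: powr_power)
    moreover have "real (n + 2) \<le> real (n + 2) ^ N"
      using N(1) by (intro self_le_power) auto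
    ultimately have "1 \<le> (real (n + 2) * ?Q * \<delta> powr ?e) ^ N"
      using one Q \<delta> unfolding power_mult_distrib
      by (smt (verit) mult_right_mono zero_le_power)
    then show ?thesis
      using Q \<delta> N(1) by (metis linorder_not_le mult_nonneg_nonneg of_nat_0_le_iff powr_ge_zero power_less_one_iff)
  qed
  then have "real k \<le> 4 * (real n)\<^sup>2 * real (n + 2) * \<delta> powr ?e * real_of_int (z - h 0)"
    using k(2) by (simp add: field_simps)
  then show ?thesis
    using h_in[OF k(2)] by (auto simp: k_def)
qed

section \<open>Integer points close to a polynomial curve\<close>

theorem theorem1p1:
  fixes n :: nat
  assumes "n \<ge> 1"
  shows "\<exists>C::real. C > 0 \<and>
    (\<forall>(f::real poly) (\<delta>::real) (X::real).
       degree f = n \<longrightarrow> 0 \<le> \<delta> \<longrightarrow> \<delta> \<le> 1/4 \<longrightarrow> X \<ge> 2 \<longrightarrow>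
       real (num_points f \<delta> X)
         \<le> C * (\<delta> powr (2 / (real n * (real n + 1))) * X
                 + real (max_points_on_poly n f \<delta> X)))"
proof -
  define C where "C = 4 * (real n)\<^sup>2 * real (n + 2)"
  have n2: "(real n)\<^sup>2 \<ge> 1" using assms by simp
  have "1 * 1 \<le> (4 * (real n)\<^sup>2) * real (n + 2)"
    using n2 by (intro mult_mono) auto
  then have C: "C \<ge> 1" by (simp add: C_def)
  show ?thesis
  proof (intro exI[of _ C] conjI allI impI)
    show "C > 0" using C by simp
    fix f :: "real poly" and \<delta> X :: real
    assume f: "degree f = n" and \<delta>: "0 \<le> \<delta>" "\<delta> \<le> 1/4" and X: "X \<ge> 2"
    define Y where "Y = (\<lambda>x::int. round (poly f (real_of_int x)))"
    define G where "G = {x::int. X \<le> real_of_int x \<and> real_of_int x \<le> 2 * X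
        \<and> \<bar>real_of_int (Y x) - poly f (real_of_int x)\<bar> \<le> \<delta>}"
    define pt where "pt = (\<lambda>x::int. (real_of_int x, real_of_int (Y x)))"
    have inj: "inj_on pt A" for A by (auto simp: inj_on_def pt_def)
    have pts: "curve_nbhd f \<delta> X \<inter> integer_points = pt ` G"
    proof (intro equalityI subsetI)
      fix p assume p: "p \<in> curve_nbhd f \<delta> X \<inter> integer_points"
      then obtain x y :: int where xy: "p = (real_of_int x, real_of_int y)"
        by (auto simp: integer_points_def Ints_def)
      have c: "X \<le> real_of_int x" "real_of_int x \<le> 2 * X" "\<bar>real_of_int y - poly f (real_of_int x)\<bar> \<le> \<delta>"
        using p by (auto simp: xy curve_nbhd_def)
      then have "\<bar>poly f (real_of_int x) - real_of_int y\<bar> < 1/2" using \<delta> by linarith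
      then have "Y x = y" unfolding Y_def by (rule round_unique')
      then show "p \<in> pt ` G" using c xy by (auto simp: G_def pt_def)
    qed (auto simp: G_def pt_def curve_nbhd_def integer_points_def)
    have finG: "finite G"
      using finite_nbhd_integer_points[of f \<delta> X] inj unfolding pts by (rule finite_imageD)
    have S: "num_points f \<delta> X = card G"
      unfolding num_points_def pts using inj by (rule card_image)
    define R where "R = max_points_on_poly n f \<delta> X"
    let ?on = "\<lambda>H. \<exists>P. degree P \<le> n \<and> (\<forall>x\<in>H. poly P (real_of_int x) = real_of_int (Y x))"
    let ?\<kappa> = "C * \<delta> powr (2 / (real n * (real n + 1)))"
    have "real (card G) \<le> real R + ?\<kappa> * (2 * X - X)"
    proof (rule card_le_runs[OF finG, where on = ?on])
      show "0 \<le> ?\<kappa>" using C by simp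
      show "?on {x}" for x
        by (rule exI[of _ "[:real_of_int (Y x):]"]) simp
    next
      fix H assume HG: "H \<subseteq> G" and "?on H"
      then obtain P where P: "degree P \<le> n" "\<And>x. x \<in> H \<Longrightarrow> poly P (real_of_int x) = real_of_int (Y x)"
        by blast
      have "card H = card (pt ` H)" using inj by (simp add: card_image)
      also have "\<dots> \<le> num_points_on f \<delta> X P"
        unfolding num_points_on_def pts
      proof (rule card_mono)
        show "finite {(x, y). (x, y) \<in> pt ` G \<and> y = poly P x}"
          by (rule finite_subset[of _ "pt ` G"]) (use finG in auto)
        show "pt ` H \<subseteq> {(x, y). (x, y) \<in> pt ` G \<and> y = poly P x}"
          using HG P(2) by (auto simp: pt_def)
      qed
      also have "\<dots> \<le> R"
        unfolding R_def max_points_on_poly_def using P(1)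
        by (intro Max_ge finite_num_points_on) auto
      finally show "real (card H) \<le> real R" by simp
    next
      fix H z
      assume H: "H \<subseteq> G" "z \<in> G" "H \<noteq> {}" "\<And>x. x \<in> H \<Longrightarrow> x < z" "?on H" "\<not> ?on (insert z H)"
      then obtain P where P: "degree P \<le> n" "\<And>x. x \<in> H \<Longrightarrow> poly P (real_of_int x) = real_of_int (Y x)"
        by blast
      show "\<exists>x\<in>H. real (card H) \<le> ?\<kappa> * real_of_int (z - x)"
        unfolding C_def
        by (rule card_run_le[OF assms _ _ H(3,4) P _ H(6)])
           (use f H finite_subset[OF H(1) finG] in \<open>auto simp: G_def\<close>)
    qed (use X in \<open>auto simp: G_def\<close>)
    also have "\<dots> \<le> C * (\<delta> powr (2 / (real n * (real n + 1))) * X + real R)"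
      using mult_right_mono[OF C, of "real R"] by (simp add: algebra_simps)
    finally show "real (num_points f \<delta> X)
         \<le> C * (\<delta> powr (2 / (real n * (real n + 1))) * X
                 + real (max_points_on_poly n f \<delta> X))"
      by (simp add: S R_def)
  qed
qed

end
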